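(* Let $n$ be a positive integer and let $\alpha\in\operatorname{Comp}(n)$. Then $$\eta_\alpha=2\sum_{\gamma\in\operatorname{Comp}(n)}(-1)^{|\operatorname{Des}(\gamma)\setminus\operatorname{Des}(\alpha)|}L_\gamma.$$
   Context: $\mathbf{k}$ is a fixed commutative ring; all functions below are power series in $\mathbf{k}[[x_1,x_2,\ldots]]$ (elements of the ring $\operatorname{QSym}$ of quasisymmetric functions). A composition of $n$ is a finite sequence $\alpha=(\alpha_1,\ldots,\alpha_p)$ of positive integers with sum $n$; its length is $\ell(\alpha)=p$, and $\operatorname{Comp}(n)$ is the set of compositions of $n$. For $\alpha\in\operatorname{Comp}(n)$, $\operatorname{Des}(\alpha)=\{\alpha_1,\alpha_1+\alpha_2,\ldots,\alpha_1+\cdots+\alpha_{p-1}\}\subseteq\{1,\ldots,n-1\}$. Monomial quasisymmetric function: $M_\alpha=\sum_{i_1<\cdots<i_p}x_{i_1}^{\alpha_1}\cdots x_{i_p}^{\alpha_p}$. Fundamental quasisymmetric function: $L_\alpha=\sum x_{i_1}x_{i_2}\cdots x_{i_n}$, summed over all $i_1\le\cdots\le i_n$ such that $i_j<i_{j+1}$ for every $j\in\operatorname{Des}(\alpha)$. (Indices are positive integers.) Enriched monomial function: $\eta_\alpha=\sum_{\beta\in\operatorname{Comp}(n),\ \operatorname{Des}(\beta)\subseteq\operatorname{Des}(\alpha)}2^{\ell(\beta)}M_\beta$. *)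

theory Defs
  imports Complex_Main "HOL-Library.Multiset"
begin

section \<open>Formal power series in arbitrarily many commuting variables\<close>

text \<open>
  A monomial is a finite multiset of variables; a power series over \<open>'k\<close> is an arbitrary family of
  coefficients indexed by monomials.
\<close>

typedef ('v, 'k) mfps = "UNIV :: ('v multiset \<Rightarrow> 'k) set"
  morphisms coeff Abs_mfps
  by simp

lemma mfps_eqI: "(\<And>m. coeff f m = coeff g m) \<Longrightarrow> f = g"
  by (metis coeff_inject ext)

lemma coeff_Abs_mfps [simp]: "coeff (Abs_mfps f) = f"
  by (simp add: Abs_mfps_inverse)

lemma finite_submultisets: "finite {a. a \<subseteq># m}"
proof (rule finite_subset)
  show "{a. a \<subseteq># m} \<subseteq> mset ` {xs. set xs \<subseteq> set_mset m \<and> length xs \<le> size m}"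
  proof
    fix a assume "a \<in> {a. a \<subseteq># m}"
    then have a: "a \<subseteq># m" by simp
    obtain xs where xs: "mset xs = a" using ex_mset by blast
    have "set xs \<subseteq> set_mset m" using set_mset_mono[OF a] xs by auto
    moreover have "length xs \<le> size m" using size_mset_mono[OF a] xs by auto
    ultimately show "a \<in> mset ` {xs. set xs \<subseteq> set_mset m \<and> length xs \<le> size m}"
      using xs by blast
  qed
  show "finite (mset ` {xs. set xs \<subseteq> set_mset m \<and> length xs \<le> size m})"
    by (intro finite_imageI finite_lists_length_le) simp
qed

lemma finite_splits: "finite {(a, b). a + b = (m :: 'v multiset)}"
proof (rule finite_subset)
  show "{(a, b). a + b = m} \<subseteq> {a. a \<subseteq># m} \<times> {a. a \<subseteq># m}" by auto
  show "finite ({a. a \<subseteq># m} \<times> {a. a \<subseteq># m})" by (simp add: finite_submultisets)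
qed

instantiation mfps :: (type, comm_ring_1) comm_ring_1
begin

definition zero_mfps :: "('a, 'b) mfps" where
  "zero_mfps = Abs_mfps (\<lambda>m. 0)"

definition one_mfps :: "('a, 'b) mfps" where
  "one_mfps = Abs_mfps (\<lambda>m. if m = {#} then 1 else 0)"

definition plus_mfps :: "('a, 'b) mfps \<Rightarrow> ('a, 'b) mfps \<Rightarrow> ('a, 'b) mfps" where
  "f + g = Abs_mfps (\<lambda>m. coeff f m + coeff g m)"

definition uminus_mfps :: "('a, 'b) mfps \<Rightarrow> ('a, 'b) mfps" where
  "- f = Abs_mfps (\<lambda>m. - coeff f m)"

definition minus_mfps :: "('a, 'b) mfps \<Rightarrow> ('a, 'b) mfps \<Rightarrow> ('a, 'b) mfps" where
  "f - g = Abs_mfps (\<lambda>m. coeff f m - coeff g m)"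

definition times_mfps :: "('a, 'b) mfps \<Rightarrow> ('a, 'b) mfps \<Rightarrow> ('a, 'b) mfps" where
  "f * g = Abs_mfps (\<lambda>m. \<Sum>(a, b)\<in>{(a, b). a + b = m}. coeff f a * coeff g b)"

instance
proof
  fix f g h :: "('a, 'b) mfps"
  show "f + g + h = f + (g + h)" "f + g = g + f" "0 + f = f" "- f + f = 0" "f - g = f + - g"
    by (simp_all add: plus_mfps_def zero_mfps_def uminus_mfps_def minus_mfps_def ac_simps
        mfps_eqI)
  show "(0 :: ('a, 'b) mfps) \<noteq> 1"
  proof
    assume "(0 :: ('a, 'b) mfps) = 1"
    then have "coeff (0 :: ('a, 'b) mfps) {#} = coeff 1 {#}" by simp
    then show False by (simp add: zero_mfps_def one_mfps_def)
  qed
  show "f * g = g * f"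
  proof (rule mfps_eqI)
    fix m
    show "coeff (f * g) m = coeff (g * f) m"
      unfolding times_mfps_def coeff_Abs_mfps
      by (rule sum.reindex_bij_witness[of _ "\<lambda>(a, b). (b, a)" "\<lambda>(a, b). (b, a)"])
        (auto simp: ac_simps)
  qed
  show "(f + g) * h = f * h + g * h"
    by (rule mfps_eqI)
      (simp add: times_mfps_def plus_mfps_def distrib_right sum.distrib split_beta)
  show "1 * f = f"
  proof (rule mfps_eqI)
    fix m :: "'a multiset"
    have "coeff (1 * f) m
        = (\<Sum>(a, b)\<in>{(a, b). a + b = m}. (if a = {#} then 1 else 0) * coeff f b)"
      by (simp add: times_mfps_def one_mfps_def)
    also have "\<dots> = (\<Sum>(a, b)\<in>{({#} :: 'a multiset, m)}. (if a = {#} then 1 else 0) * coeff f b)"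
      by (rule sum.mono_neutral_right) (use finite_splits[of m] in \<open>auto split: if_splits\<close>)
    finally show "coeff (1 * f) m = coeff f m" by simp
  qed
  show "f * g * h = f * (g * h)"
  proof (rule mfps_eqI)
    fix m :: "'a multiset"
    let ?S = "\<lambda>m :: 'a multiset. {(a, b). a + b = m}"
    have "coeff (f * g * h) m
        = (\<Sum>p\<in>?S m. \<Sum>q\<in>?S (fst p). coeff f (fst q) * coeff g (snd q) * coeff h (snd p))"
      by (simp add: times_mfps_def split_beta sum_distrib_right)
    also have "\<dots> = (\<Sum>(p, q)\<in>Sigma (?S m) (\<lambda>p. ?S (fst p)).
        coeff f (fst q) * coeff g (snd q) * coeff h (snd p))"
      by (rule sum.Sigma) (auto simp: finite_splits)
    also have "\<dots> = (\<Sum>(p, q)\<in>Sigma (?S m) (\<lambda>p. ?S (snd p)).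
        coeff f (fst p) * (coeff g (fst q) * coeff h (snd q)))"
      by (rule sum.reindex_bij_witness[of _
            "\<lambda>((a, r), (b, c)). ((a + b, c), (a, b))" "\<lambda>((r, c), (a, b)). ((a, b + c), (b, c))"])
        (auto simp: ac_simps)
    also have "\<dots> = (\<Sum>p\<in>?S m. \<Sum>q\<in>?S (snd p).
        coeff f (fst p) * (coeff g (fst q) * coeff h (snd q)))"
      by (rule sum.Sigma[symmetric]) (auto simp: finite_splits)
    also have "\<dots> = coeff (f * (g * h)) m"
      by (simp add: times_mfps_def split_beta sum_distrib_left)
    finally show "coeff (f * g * h) m = coeff (f * (g * h)) m" .
  qed
qed

end

definition var :: "'v \<Rightarrow> ('v, 'k :: comm_ring_1) mfps" where
  "var i = Abs_mfps (\<lambda>m. if m = {#i#} then 1 else 0)"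

text \<open>
  A possibly infinite family of power series may be summed if every monomial occurs in only finitely
  many members; the sum is then taken coefficientwise. Outside this case the value of
  \<open>formal_sum\<close> is meaningless; both families summed below are shown to be locally finite.
\<close>

definition locally_finite :: "('i \<Rightarrow> ('v, 'k :: comm_ring_1) mfps) \<Rightarrow> 'i set \<Rightarrow> bool" where
  "locally_finite f I \<longleftrightarrow> (\<forall>m. finite {i \<in> I. coeff (f i) m \<noteq> 0})"

definition formal_sum :: "('i \<Rightarrow> ('v, 'k :: comm_ring_1) mfps) \<Rightarrow> 'i set \<Rightarrow> ('v, 'k) mfps" where
  "formal_sum f I = Abs_mfps (\<lambda>m. \<Sum>i | i \<in> I \<and> coeff (f i) m \<noteq> 0. coeff (f i) m)"

lemma formal_sum_finite: "finite I \<Longrightarrow> formal_sum f I = (\<Sum>i\<in>I. f i)"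
proof -
  assume fin: "finite I"
  have coeff_sum: "coeff (\<Sum>i\<in>J. f i) m = (\<Sum>i\<in>J. coeff (f i) m)" for J m
    by (induction J rule: infinite_finite_induct) (auto simp: zero_mfps_def plus_mfps_def)
  show ?thesis
    by (rule mfps_eqI)
      (use fin in \<open>auto simp: formal_sum_def coeff_sum intro!: sum.mono_neutral_left\<close>)
qed


section \<open>Compositions\<close>

definition Comp :: "nat \<Rightarrow> nat list set" where
  "Comp n = {\<alpha>. (\<forall>a\<in>set \<alpha>. 0 < a) \<and> sum_list \<alpha> = n}"

definition Des :: "nat list \<Rightarrow> nat set" where
  "Des \<alpha> = {sum_list (take k \<alpha>) | k. 1 \<le> k \<and> k < length \<alpha>}"

lemma finite_Comp: "finite (Comp n)"
proof (rule finite_subset)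
  have "length \<alpha> \<le> sum_list \<alpha>" if "\<forall>a\<in>set \<alpha>. 0 < a" for \<alpha> :: "nat list"
    using that by (induction \<alpha>) auto
  then show "Comp n \<subseteq> {\<alpha>. set \<alpha> \<subseteq> {..n} \<and> length \<alpha> \<le> n}"
    by (auto simp: Comp_def intro: member_le_sum_list)
  show "finite {\<alpha>. set \<alpha> \<subseteq> {..n} \<and> length \<alpha> \<le> n}"
    by (rule finite_lists_length_le) simp
qed


section \<open>Quasisymmetric functions\<close>

text \<open>
  The variables \<open>x\<^sub>1, x\<^sub>2, \<dots>\<close> are \<open>var 1, var 2, \<dots>\<close>; \<open>var 0\<close> is never used. List positions
  count from 0, so the entry \<open>i\<^sub>j\<close> of an index sequence \<open>s\<close> is \<open>s ! (j - 1)\<close>.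
\<close>

definition strict_seqs :: "nat list \<Rightarrow> nat list set" where
  "strict_seqs \<alpha> = {s. length s = length \<alpha> \<and> (\<forall>i\<in>set s. 1 \<le> i) \<and> sorted_wrt (<) s}"

definition monomial_qsym :: "nat list \<Rightarrow> (nat, 'k :: comm_ring_1) mfps" where
  "monomial_qsym \<alpha> =
     formal_sum (\<lambda>s. \<Prod>j<length \<alpha>. var (s ! j) ^ (\<alpha> ! j)) (strict_seqs \<alpha>)"

definition descent_seqs :: "nat list \<Rightarrow> nat list set" where
  "descent_seqs \<alpha> = {s. length s = sum_list \<alpha> \<and> (\<forall>i\<in>set s. 1 \<le> i) \<and> sorted_wrt (\<le>) s \<and>
                        (\<forall>j\<in>Des \<alpha>. s ! (j - 1) < s ! j)}"

definition fundamental_qsym :: "nat list \<Rightarrow> (nat, 'k :: comm_ring_1) mfps" where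
  "fundamental_qsym \<alpha> = formal_sum (\<lambda>s. \<Prod>j<sum_list \<alpha>. var (s ! j)) (descent_seqs \<alpha>)"

definition enriched_monomial_qsym :: "nat list \<Rightarrow> (nat, 'k :: comm_ring_1) mfps" where
  "enriched_monomial_qsym \<alpha> =
     (\<Sum>\<beta> | \<beta> \<in> Comp (sum_list \<alpha>) \<and> Des \<beta> \<subseteq> Des \<alpha>. 2 ^ length \<beta> * monomial_qsym \<beta>)"


subsection \<open>Local finiteness\<close>

definition monomial :: "'v multiset \<Rightarrow> ('v, 'k :: comm_ring_1) mfps" where
  "monomial a = Abs_mfps (\<lambda>m. if m = a then 1 else 0)"

lemma coeff_monomial: "coeff (monomial a) m = (if m = a then 1 else 0)"
  by (simp add: monomial_def)

lemma var_eq_monomial: "var i = monomial {#i#}"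
  by (simp add: var_def monomial_def)

lemma one_eq_monomial: "1 = monomial {#}"
  by (simp add: one_mfps_def monomial_def)

lemma monomial_mult:
  "monomial a * monomial b = (monomial (a + b) :: ('v, 'k :: comm_ring_1) mfps)"
proof (rule mfps_eqI)
  fix m
  have "coeff (monomial a * monomial b :: ('v, 'k) mfps) m
      = (\<Sum>p\<in>{(a, b). a + b = m}. if p = (a, b) then 1 else 0)"
    by (auto simp: times_mfps_def coeff_monomial split_beta intro!: sum.cong)
  then show "coeff (monomial a * monomial b :: ('v, 'k) mfps) m = coeff (monomial (a + b)) m"
    by (auto simp: finite_splits coeff_monomial)
qed

lemma var_power: "var i ^ k = monomial (replicate_mset k i)"
  by (induction k) (simp_all add: one_eq_monomial var_eq_monomial monomial_mult)

lemma prod_monomial: "(\<Prod>j\<in>J. monomial (g j)) = monomial (\<Sum>j\<in>J. g j)"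
  by (induction J rule: infinite_finite_induct) (simp_all add: one_eq_monomial monomial_mult)

lemma strict_seq_monomial:
  "(\<Prod>j<length \<alpha>. var (s ! j) ^ (\<alpha> ! j))
     = monomial (\<Sum>j<length \<alpha>. replicate_mset (\<alpha> ! j) (s ! j))"
  by (simp add: var_power prod_monomial)

lemma descent_seq_monomial: "length s = n \<Longrightarrow> (\<Prod>j<n. var (s ! j)) = monomial (mset s)"
proof -
  assume len: "length s = n"
  have "(\<Sum>j<length s. {#s ! j#}) = mset s"
    by (induction s rule: rev_induct) (simp_all add: nth_append)
  then show ?thesis using len by (simp add: var_eq_monomial prod_monomial)
qed

lemma locally_finite_descent_seqs:
  "locally_finite (\<lambda>s. \<Prod>j<sum_list \<alpha>. var (s ! j) :: (nat, 'k :: comm_ring_1) mfps)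
     (descent_seqs \<alpha>)"
  unfolding locally_finite_def
proof
  fix m :: "nat multiset"
  let ?f = "\<lambda>s. \<Prod>j<sum_list \<alpha>. var (s ! j) :: (nat, 'k) mfps"
  have "{s \<in> descent_seqs \<alpha>. coeff (?f s) m \<noteq> 0} \<subseteq> {xs. mset xs = m}"
    by (auto simp: descent_seqs_def descent_seq_monomial coeff_monomial split: if_splits)
  moreover have "finite {xs. mset xs = m}"
    by (rule finite_subset[OF _ finite_lists_length_eq[of "set_mset m" "size m"]]) auto
  ultimately show "finite {s \<in> descent_seqs \<alpha>. coeff (?f s) m \<noteq> 0}" by (rule finite_subset)
qed

lemma locally_finite_strict_seqs:
  assumes "\<forall>a\<in>set \<alpha>. 0 < a"
  shows "locally_finite (\<lambda>s. \<Prod>j<length \<alpha>. var (s ! j) ^ (\<alpha> ! j) :: (nat, 'k :: comm_ring_1) mfps)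
           (strict_seqs \<alpha>)"
  unfolding locally_finite_def
proof
  fix m :: "nat multiset"
  let ?f = "\<lambda>s. \<Prod>j<length \<alpha>. var (s ! j) ^ (\<alpha> ! j) :: (nat, 'k) mfps"
  have "{s \<in> strict_seqs \<alpha>. coeff (?f s) m \<noteq> 0}
      \<subseteq> {s. set s \<subseteq> set_mset m \<and> length s = length \<alpha>}"
  proof safe
    fix s i
    assume s: "s \<in> strict_seqs \<alpha>" and nz: "coeff (?f s) m \<noteq> 0" and i: "i \<in> set s"
    from nz have m: "m = (\<Sum>j<length \<alpha>. replicate_mset (\<alpha> ! j) (s ! j))"
      by (simp add: strict_seq_monomial coeff_monomial split: if_splits)
    from i s obtain j where j: "j < length \<alpha>" "s ! j = i"
      by (auto simp: in_set_conv_nth strict_seqs_def)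
    with assms have "i \<in># replicate_mset (\<alpha> ! j) (s ! j)" by simp
    moreover have "replicate_mset (\<alpha> ! j) (s ! j) \<subseteq># m"
      unfolding m using j by (subst sum.remove[of _ j]) auto
    ultimately show "i \<in># m" using j by (auto dest: mset_subset_eqD)
  qed (simp add: strict_seqs_def)
  moreover have "finite {s. set s \<subseteq> set_mset m \<and> length s = length \<alpha>}"
    by (rule finite_lists_length_eq) simp
  ultimately show "finite {s \<in> strict_seqs \<alpha>. coeff (?f s) m \<noteq> 0}" by (rule finite_subset)
qed

end

theory Submission
  imports Defs
begin

text \<open>
  Compare the coefficients of a monomial \<open>m\<close> of degree \<open>n\<close>, written as \<open>x\<^bsub>s(1)\<^esub> \<cdots> x\<^bsub>s(n)\<^esub>\<close> with \<open>s\<close> weakly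
  increasing. Let \<open>A = Des \<alpha>\<close> and let \<open>D\<close> be the set of positions at which \<open>s\<close> strictly increases. The coefficient
  of \<open>m\<close> is \<open>1\<close> in \<open>L\<^sub>\<gamma>\<close> iff \<open>Des \<gamma> \<subseteq> D\<close> and \<open>1\<close> in \<open>M\<^sub>\<beta>\<close> iff \<open>Des \<beta> = D\<close>, and is \<open>0\<close> otherwise. As \<open>Des\<close>
  is a bijection from compositions of \<open>n\<close> to subsets of \<open>{1..<n}\<close>, the claim reduces to the
  evaluation of \<open>\<Sum>X\<subseteq>D. (-1)\<^bsup>|X - A|\<^esup>\<close>, which is \<open>2\<^bsup>|D|\<^esup>\<close> if \<open>D \<subseteq> A\<close> and \<open>0\<close> otherwise.
\<close>

section \<open>Descent sets of compositions\<close>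

lemma Des_Nil [simp]: "Des [] = {}"
  by (simp add: Des_def)

text \<open>Appending a part keeps all earlier partial sums and makes the old total a proper one.
  Inductions on compositions therefore run from the right.\<close>

lemma Des_snoc:
  "Des (\<alpha> @ [a]) = (if \<alpha> = [] then {} else insert (sum_list \<alpha>) (Des \<alpha>))"
proof (cases "\<alpha> = []")
  case False
  have "x \<in> Des (\<alpha> @ [a]) \<longleftrightarrow> x = sum_list \<alpha> \<or> x \<in> Des \<alpha>" for x
  proof
    assume "x \<in> Des (\<alpha> @ [a])"
    then obtain k where k: "x = sum_list (take k (\<alpha> @ [a]))" "1 \<le> k" "k < Suc (length \<alpha>)"
      by (auto simp: Des_def)
    then show "x = sum_list \<alpha> \<or> x \<in> Des \<alpha>"
      by (cases "k = length \<alpha>") (auto simp: Des_def)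
  next
    assume "x = sum_list \<alpha> \<or> x \<in> Des \<alpha>"
    then show "x \<in> Des (\<alpha> @ [a])"
    proof
      assume "x = sum_list \<alpha>"
      then show ?thesis using False
        by (auto simp: Des_def Suc_le_eq intro!: exI[of _ "length \<alpha>"])
    next
      assume "x \<in> Des \<alpha>"
      then obtain k where "x = sum_list (take k \<alpha>)" "1 \<le> k" "k < length \<alpha>"
        by (auto simp: Des_def)
      then show ?thesis
        by (auto simp: Des_def intro!: exI[of _ k])
    qed
  qed
  then show ?thesis using False by auto
qed (auto simp: Des_def)

lemma Des_subset:
  assumes "\<forall>a\<in>set \<alpha>. 0 < a"
  shows "Des \<alpha> \<subseteq> {1..<sum_list \<alpha>}"
  using assms
proof (induction \<alpha> rule: rev_induct)
  case (snoc a \<alpha>)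
  have "1 \<le> sum_list \<alpha>" if "\<alpha> \<noteq> []"
    using that snoc.prems by (cases \<alpha>) auto
  moreover have "Des \<alpha> \<subseteq> {1..<sum_list \<alpha>}" "0 < a"
    using snoc by auto
  then have "Des \<alpha> \<subseteq> {1..<sum_list (\<alpha> @ [a])}"
    by (auto dest!: subsetD)
  ultimately show ?case using \<open>0 < a\<close> by (simp add: Des_snoc)
qed simp

lemma finite_Des: "finite (Des \<alpha>)"
  by (simp add: Des_def)

text \<open>Positive parts make the partial sums distinct. This turns the weight
  \<open>2 ^ length\<close> into a function of the descent set alone.\<close>

lemma length_eq_card_Des:
  assumes "\<forall>a\<in>set \<alpha>. 0 < a" and "\<alpha> \<noteq> []"
  shows "length \<alpha> = Suc (card (Des \<alpha>))"
  using assms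
proof (induction \<alpha> rule: rev_induct)
  case (snoc a \<alpha>)
  have "sum_list \<alpha> \<notin> Des \<alpha>"
    using Des_subset[of \<alpha>] snoc.prems by auto
  with snoc show ?case by (auto simp: Des_snoc finite_Des)
qed simp

text \<open>The largest descent is the total of all parts but the last, so the descent set and the
  total determine the last part; induction recovers the rest.\<close>

lemma Des_inject:
  assumes "\<forall>a\<in>set \<alpha>. 0 < a" and "\<forall>b\<in>set \<beta>. 0 < b"
    and "sum_list \<alpha> = sum_list \<beta>" and "Des \<alpha> = Des \<beta>"
  shows "\<alpha> = \<beta>"
  using assms
proof (induction \<alpha> arbitrary: \<beta> rule: rev_induct)
  case Nil
  then show ?case by (cases \<beta>) auto
next
  case (snoc a \<alpha>)
  then obtain b \<beta>' where \<beta>: "\<beta> = \<beta>' @ [b]"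
    by (cases \<beta> rule: rev_cases) auto
  have sub: "Des \<alpha> \<subseteq> {1..<sum_list \<alpha>}" "Des \<beta>' \<subseteq> {1..<sum_list \<beta>'}"
    using snoc.prems by (intro Des_subset; simp add: \<beta>)+
  consider "\<alpha> = []" "\<beta>' = []" | "\<alpha> \<noteq> []" "\<beta>' \<noteq> []"
    using snoc.prems(4) by (auto simp: \<beta> Des_snoc split: if_splits)
  then show ?case
  proof cases
    case 1
    then show ?thesis using snoc.prems by (simp add: \<beta>)
  next
    case 2
    then have eq: "insert (sum_list \<alpha>) (Des \<alpha>) = insert (sum_list \<beta>') (Des \<beta>')"
      using snoc.prems(4) by (simp add: \<beta> Des_snoc)
    have "Max (insert (sum_list \<alpha>) (Des \<alpha>)) = sum_list \<alpha>"
      "Max (insert (sum_list \<beta>') (Des \<beta>')) = sum_list \<beta>'"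
      using sub by (intro Max_eqI; fastforce simp: finite_Des)+
    with eq have sum_eq: "sum_list \<alpha> = sum_list \<beta>'" by simp
    moreover have "Des \<alpha> = Des \<beta>'"
      \<comment> \<open>By \<open>sub\<close>, the common total lies in neither descent set, so it
        can be removed from both sides of \<open>eq\<close>.\<close>
      using eq sub sum_eq by (metis Diff_insert_absorb atLeastLessThan_iff less_irrefl subsetD)
    ultimately have "\<alpha> = \<beta>'" using snoc.prems by (intro snoc.IH) (auto simp: \<beta>)
    then show ?thesis using snoc.prems(3) sum_eq by (simp add: \<beta>)
  qed
qed

text \<open>The maximum \<open>g\<close> of \<open>G\<close> must be the total before the last part:
  a composition of \<open>g\<close> with descent set \<open>G - {g}\<close> is extended by
  \<open>n - g\<close>.\<close>

lemma Des_surj: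
  assumes "0 < n" and "G \<subseteq> {1..<n}"
  shows "G \<in> Des ` Comp n"
  using assms
proof (induction n arbitrary: G rule: less_induct)
  case (less n)
  show ?case
  proof (cases "G = {}")
    case True
    have "[n] \<in> Comp n" "Des [n] = {}"
      using less.prems by (auto simp: Comp_def Des_def)
    with True show ?thesis by auto
  next
    case False
    define g where "g = Max G"
    have fin: "finite G" using less.prems finite_subset by blast
    have g: "g \<in> G" using False fin by (simp add: g_def)
    then have g': "0 < g" "g < n" using less.prems by auto
    have "G - {g} \<subseteq> {1..<g}"
    proof
      fix x assume x: "x \<in> G - {g}"
      then have "x \<le> g" using fin by (simp add: g_def)
      with x less.prems show "x \<in> {1..<g}" by force
    qed
    then obtain \<alpha> where \<alpha>: "\<alpha> \<in> Comp g" "Des \<alpha> = G - {g}"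
      using less.IH[of g "G - {g}"] g' by auto
    then have "\<alpha> \<noteq> []" using g' by (auto simp: Comp_def)
    then have "Des (\<alpha> @ [n - g]) = G" "\<alpha> @ [n - g] \<in> Comp n"
      using \<alpha> g g' by (auto simp: Des_snoc Comp_def)
    then show ?thesis by blast
  qed
qed

lemma bij_betw_Des:
  assumes "0 < n"
  shows "bij_betw Des (Comp n) (Pow {1..<n})"
  unfolding bij_betw_def
proof
  show "inj_on Des (Comp n)"
    by (rule inj_onI) (auto simp: Comp_def intro: Des_inject)
  show "Des ` Comp n = Pow {1..<n}"
  proof
    show "Des ` Comp n \<subseteq> Pow {1..<n}"
      using Des_subset unfolding Comp_def by blast
    show "Pow {1..<n} \<subseteq> Des ` Comp n"
      using Des_surj[OF assms] by blast
  qed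
qed

section \<open>Ascents and run decompositions of sequences\<close>

text \<open>The index \<open>j\<close> marks the gap after the first \<open>j\<close> entries, the
  same convention as for \<open>Des\<close>, so the two sets can be compared directly.\<close>

definition ascents :: "nat list \<Rightarrow> nat set" where
  "ascents s = {j. 1 \<le> j \<and> j < length s \<and> s ! (j - 1) < s ! j}"

lemma ascents_subset: "ascents s \<subseteq> {1..<length s}"
  by (auto simp: ascents_def)

lemma ascents_snoc:
  "ascents (s @ [x]) = ascents s \<union> (if s \<noteq> [] \<and> last s < x then {length s} else {})"
proof -
  have mem: "j \<in> ascents (s @ [x]) \<longleftrightarrow>
      j \<in> ascents s \<or> (j = length s \<and> s \<noteq> [] \<and> last s < x)" for j
  proof -
    consider "j < length s" | "j = length s" | "length s < j" by linarith
    then show ?thesis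
    proof cases
      case 1
      then have "(s @ [x]) ! j = s ! j" "(s @ [x]) ! (j - 1) = s ! (j - 1)"
        by (simp_all add: nth_append less_imp_diff_less)
      with 1 show ?thesis by (simp add: ascents_def)
    next
      case 2
      then show ?thesis
        by (cases s rule: rev_cases) (simp_all add: ascents_def nth_append)
    next
      case 3
      then show ?thesis by (simp add: ascents_def)
    qed
  qed
  show ?thesis by (intro set_eqI) (simp add: mem)
qed

text \<open>Only the first copy of \<open>x\<close> can exceed its predecessor; every later copy
  follows an equal entry.\<close>

lemma ascents_append_replicate:
  assumes "\<forall>y\<in>set s. y < x" and "0 < b"
  shows "ascents (s @ replicate b x) = (if s = [] then {} else insert (length s) (ascents s))"
  using assms(2)
proof (induction b)
  case (Suc b)
  have eq: "s @ replicate (Suc b) x = (s @ replicate b x) @ [x]"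
    by (simp add: replicate_append_same)
  show ?case
  proof (cases b)
    case 0
    have "ascents [] = {}" by (simp add: ascents_def)
    then show ?thesis using 0 assms(1) by (auto simp: ascents_snoc)
  next
    case (Suc c)
    then show ?thesis unfolding eq by (subst ascents_snoc) (use Suc.IH in auto)
  qed
qed simp

text \<open>Run-length decoding, with run lengths \<beta> and values \<open>t\<close>: it turns a
  strict index sequence into the weakly increasing word of the same monomial.\<close>

definition expand :: "nat list \<Rightarrow> nat list \<Rightarrow> nat list" where
  "expand \<beta> t = concat (map2 replicate \<beta> t)"

lemma expand_Nil [simp]: "expand [] [] = []"
  by (simp add: expand_def)

lemma expand_snoc:
  "length \<beta> = length t \<Longrightarrow> expand (\<beta> @ [b]) (t @ [x]) = expand \<beta> t @ replicate b x"
  by (simp add: expand_def)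

lemma length_expand: "length \<beta> = length t \<Longrightarrow> length (expand \<beta> t) = sum_list \<beta>"
  by (induction \<beta> t rule: list_induct2) (simp_all add: expand_def)

lemma set_expand:
  assumes "length \<beta> = length t" and "\<forall>b\<in>set \<beta>. 0 < b"
  shows "set (expand \<beta> t) = set t"
  using assms by (induction \<beta> t rule: list_induct2) (auto simp: expand_def)

lemma mset_expand:
  assumes "length \<beta> = length t"
  shows "mset (expand \<beta> t) = (\<Sum>j<length \<beta>. replicate_mset (\<beta> ! j) (t ! j))"
  using assms
  by (induction \<beta> t rule: list_induct2)
    (simp_all add: expand_def sum.lessThan_Suc_shift del: sum.lessThan_Suc)

text \<open>Ascents occur exactly where a new run begins, and these positions are the proper partial
  sums of the run lengths.\<close>

lemma sorted_expand_and_ascents_expand: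
  assumes "length t = length \<beta>" and "\<forall>b\<in>set \<beta>. 0 < b" and "sorted_wrt (<) t"
  shows "sorted (expand \<beta> t) \<and> ascents (expand \<beta> t) = Des \<beta>"
  using assms
proof (induction \<beta> arbitrary: t rule: rev_induct)
  case Nil
  then show ?case by (simp add: ascents_def)
next
  case (snoc b \<beta>)
  then obtain u x where t: "t = u @ [x]" and len: "length \<beta> = length u"
    by (cases t rule: rev_cases) auto
  have IH: "sorted (expand \<beta> u)" "ascents (expand \<beta> u) = Des \<beta>"
    using snoc.IH[of u] snoc.prems len by (auto simp: t sorted_wrt_append)
  have less: "\<forall>y\<in>set (expand \<beta> u). y < x"
    using snoc.prems len by (simp add: set_expand t sorted_wrt_append)
  have "expand \<beta> u = [] \<longleftrightarrow> \<beta> = []"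
    using set_expand[OF len] snoc.prems len by auto
  moreover have "ascents (expand (\<beta> @ [b]) t) =
      (if expand \<beta> u = [] then {} else insert (sum_list \<beta>) (Des \<beta>))"
    using ascents_append_replicate[OF less, of b] snoc.prems len IH
    by (simp add: t expand_snoc length_expand)
  ultimately show ?case
    using IH less len by (auto simp: t expand_snoc Des_snoc sorted_append)
qed

text \<open>Reading the word from left to right, each new letter either opens a run of length 1 or
  lengthens the last run.\<close>

lemma sorted_imp_expand:
  assumes "sorted s"
  obtains \<beta> t where "length t = length \<beta>" "\<forall>b\<in>set \<beta>. 0 < b" "sorted_wrt (<) t"
    "expand \<beta> t = s"
proof -
  have "\<exists>\<beta> t. length t = length \<beta> \<and> (\<forall>b\<in>set \<beta>. 0 < b) \<and> sorted_wrt (<) t \<and> expand \<beta> t = s"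
    using assms
  proof (induction s rule: rev_induct)
    case Nil
    show ?case by (intro exI[of _ "[]"]) simp
  next
    case (snoc x s)
    then obtain \<beta> t where IH: "length t = length \<beta>" "\<forall>b\<in>set \<beta>. 0 < b" "sorted_wrt (<) t"
      "expand \<beta> t = s"
      by (auto simp: sorted_append)
    have le: "\<forall>y\<in>set t. y \<le> x"
      using snoc.prems set_expand[of \<beta> t] IH by (auto simp: sorted_append)
    show ?case
    proof (cases "x \<in> set t")
      case False
      then have "\<forall>y\<in>set t. y < x" using le by (metis nat_less_le)
      then have "sorted_wrt (<) (t @ [x])" using IH(3) by (simp add: sorted_wrt_append)
      moreover have "expand (\<beta> @ [1]) (t @ [x]) = s @ [x]"
        using IH(1,4) by (simp add: expand_snoc)
      moreover have "length (t @ [x]) = length (\<beta> @ [1])" "\<forall>b\<in>set (\<beta> @ [1]). 0 < b"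
        using IH(1,2) by auto
      ultimately show ?thesis by blast
    next
      case True
      then obtain u y where t: "t = u @ [y]" by (cases t rule: rev_cases) auto
      \<comment> \<open>All entries of \<open>t\<close> are at most \<open>x\<close> and
        \<open>t\<close> is strictly increasing, so an occurrence of \<open>x\<close> must be its
        last entry.\<close>
      have "y = x" using True le IH(3) by (force simp: t sorted_wrt_append)
      moreover obtain \<gamma> c where \<beta>: "\<beta> = \<gamma> @ [c]"
        using IH(1) by (cases \<beta> rule: rev_cases) (auto simp: t)
      ultimately have "expand (\<gamma> @ [Suc c]) t = s @ [x]"
        using IH(1,4) by (auto simp: t expand_snoc replicate_append_same)
      moreover have "length t = length (\<gamma> @ [Suc c])" "\<forall>b\<in>set (\<gamma> @ [Suc c]). 0 < b"
        using IH(1,2) by (auto simp: \<beta>)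
      ultimately show ?thesis using IH(3) by blast
    qed
  qed
  with that show thesis by blast
qed

section \<open>Coefficients\<close>

lemma coeff_sum: "coeff (\<Sum>i\<in>J. f i) m = (\<Sum>i\<in>J. coeff (f i) m)"
  by (induction J rule: infinite_finite_induct) (auto simp: zero_mfps_def plus_mfps_def)

text \<open>The scalars \<open>2\<close> and \<open>- 1\<close> of the theorem are power series;
  this lemma and the next ones move their powers out of coefficients.\<close>

lemma coeff_two_times: "coeff (2 * f) m = 2 * coeff f m"
  unfolding mult_2 by (simp add: plus_mfps_def)

lemma coeff_two_power_times: "coeff (2 ^ k * f) m = 2 ^ k * coeff f m"
  by (induction k) (simp_all add: mult.assoc coeff_two_times)

lemma coeff_uminus: "coeff (- f) m = - coeff f m"
  by (simp add: uminus_mfps_def)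

lemma coeff_neg_one_power_times: "coeff ((- 1) ^ k * f) m = (- 1) ^ k * coeff f m"
  by (induction k) (simp_all add: mult.assoc coeff_uminus)

text \<open>Extracting a coefficient becomes counting indices. If infinitely many indices qualify,
  both sides are 0 by convention.\<close>

lemma coeff_formal_sum_monomial:
  assumes "\<And>s. s \<in> I \<Longrightarrow> f s = monomial (g s)"
  shows "coeff (formal_sum f I) m = of_nat (card {s \<in> I. g s = m})"
proof -
  have "{s. s \<in> I \<and> coeff (f s) m \<noteq> 0} = {s \<in> I. g s = m}"
    using assms by (auto simp: coeff_monomial split: if_splits)
  moreover have "(\<Sum>s | s \<in> I \<and> g s = m. coeff (f s) m) = (\<Sum>s | s \<in> I \<and> g s = m. 1)"
    by (rule sum.cong) (auto simp: assms coeff_monomial)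
  ultimately show ?thesis by (simp add: formal_sum_def)
qed

abbreviation sorted_of :: "nat multiset \<Rightarrow> nat list" where
  "sorted_of \<equiv> sorted_list_of_multiset"

text \<open>A multiset has exactly one weakly increasing arrangement, so at most one index sequence
  contributes. The condition on 0 reflects that variables are numbered from 1.\<close>

lemma coeff_fundamental_qsym:
  assumes "\<gamma> \<in> Comp n"
  shows "coeff (fundamental_qsym \<gamma> :: (nat, 'k :: comm_ring_1) mfps) m =
    (if size m = n \<and> 0 \<notin># m \<and> Des \<gamma> \<subseteq> ascents (sorted_of m) then 1 else 0)"
proof -
  have sum: "sum_list \<gamma> = n" and Des: "Des \<gamma> \<subseteq> {1..<n}"
    using assms Des_subset by (auto simp: Comp_def)
  have seqs: "{s \<in> descent_seqs \<gamma>. mset s = m} =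
    (if size m = n \<and> 0 \<notin># m \<and> Des \<gamma> \<subseteq> ascents (sorted_of m) then {sorted_of m} else {})"
    (is "?L = ?R")
  proof -
    have mem: "s \<in> descent_seqs \<gamma> \<longleftrightarrow>
        sorted s \<and> length s = n \<and> 0 \<notin> set s \<and> Des \<gamma> \<subseteq> ascents s" for s
      using Des by (auto simp: descent_seqs_def sum ascents_def Suc_le_eq) (metis gr0I)
    have "s \<in> ?L \<longleftrightarrow>
        (sorted s \<and> mset s = m) \<and> size m = n \<and> 0 \<notin># m \<and> Des \<gamma> \<subseteq> ascents s" for s
      unfolding mem_Collect_eq mem by auto
    moreover have "sorted s \<and> mset s = m \<longleftrightarrow> s = sorted_of m" for s
      by (auto simp: sorted_sort_id)
    ultimately have "s \<in> ?L \<longleftrightarrow>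
        s = sorted_of m \<and> size m = n \<and> 0 \<notin># m \<and> Des \<gamma> \<subseteq> ascents s" for s
      by simp
    then show ?thesis by (intro set_eqI) auto
  qed
  have "coeff (fundamental_qsym \<gamma> :: (nat, 'k) mfps) m =
      of_nat (card {s \<in> descent_seqs \<gamma>. mset s = m})"
    unfolding fundamental_qsym_def
    by (rule coeff_formal_sum_monomial) (simp add: descent_seqs_def descent_seq_monomial)
  then show ?thesis unfolding seqs by simp
qed

lemma coeff_monomial_qsym:
  assumes "\<beta> \<in> Comp n"
  shows "coeff (monomial_qsym \<beta> :: (nat, 'k :: comm_ring_1) mfps) m =
    (if size m = n \<and> 0 \<notin># m \<and> Des \<beta> = ascents (sorted_of m) then 1 else 0)"
proof -
  have sum: "sum_list \<beta> = n" and pos: "\<forall>b\<in>set \<beta>. 0 < b"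
    using assms by (auto simp: Comp_def)
  let ?S = "{t \<in> strict_seqs \<beta>. mset (expand \<beta> t) = m}"
  \<comment> \<open>The last conjunct recovers \<open>t\<close> from the support of
    \<open>m\<close>, so \<open>?S\<close> has at most one element.\<close>
  have S: "size m = n \<and> 0 \<notin># m \<and> Des \<beta> = ascents (sorted_of m) \<and> t = sorted_list_of_set (set_mset m)"
    if "t \<in> ?S" for t
  proof -
    have t: "length t = length \<beta>" "0 \<notin> set t" "sorted_wrt (<) t" and m: "m = mset (expand \<beta> t)"
      using that by (auto simp: strict_seqs_def)
    have set: "set_mset m = set t" using t pos by (simp add: m set_expand)
    have "sorted_of m = expand \<beta> t" "ascents (expand \<beta> t) = Des \<beta>"
      using sorted_expand_and_ascents_expand[of t \<beta>] t pos by (auto simp: m sorted_sort_id)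
    moreover have "size m = n" using t by (simp add: m length_expand sum)
    moreover have "t = sorted_list_of_set (set t)"
      using t(3) by (simp add: strict_sorted_equal strict_sorted_iff)
    ultimately show ?thesis using t set by simp
  qed
  have card: "card ?S = (if size m = n \<and> 0 \<notin># m \<and> Des \<beta> = ascents (sorted_of m) then 1 else 0)"
  proof (cases "size m = n \<and> 0 \<notin># m \<and> Des \<beta> = ascents (sorted_of m)")
    case True
    \<comment> \<open>The witness is the run decomposition of the sorted word; its run lengths have
      the same total and descent set as \<beta>, hence equal \<beta>.\<close>
    obtain \<beta>' t where t: "length t = length \<beta>'" "\<forall>b\<in>set \<beta>'. 0 < b" "sorted_wrt (<) t"
      "expand \<beta>' t = sorted_of m"
      by (rule sorted_imp_expand[OF sorted_sorted_list_of_multiset])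
    have m: "mset (expand \<beta>' t) = m" by (simp add: t(4))
    have "sum_list \<beta>' = n"
      using True t(1) length_expand[of \<beta>' t] m by (metis size_mset)
    moreover have "Des \<beta>' = Des \<beta>"
      using True sorted_expand_and_ascents_expand[OF t(1-3)] t(4) by simp
    ultimately have "\<beta>' = \<beta>" using Des_inject[of \<beta>' \<beta>] t(2) pos sum by simp
    moreover have "0 \<notin> set t" using True t m set_expand[of \<beta>' t] by (metis set_mset_mset)
    ultimately have "t \<in> ?S"
      using t m by (auto simp: strict_seqs_def Suc_le_eq intro: gr0I)
    with S have "?S = {t}" by blast
    with True show ?thesis by simp
  next
    case False
    with S have "?S = {}" by blast
    then have "card ?S = 0" by (simp only: card.empty)
    with False show ?thesis by auto
  qed
  have "coeff (monomial_qsym \<beta> :: (nat, 'k) mfps) m = of_nat (card ?S)"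
    unfolding monomial_qsym_def
    by (rule coeff_formal_sum_monomial)
      (simp add: strict_seqs_def strict_seq_monomial mset_expand)
  then show ?thesis unfolding card by simp
qed

section \<open>Signed subset sum and comparison of coefficients\<close>

text \<open>The sum is the expansion of a product over \<open>D\<close> with factor 1 + 1 for
  elements of \<open>A\<close> and -1 + 1 for the others.\<close>

lemma sum_Pow_neg_one_power_card_Diff:
  assumes "finite D"
  shows "(\<Sum>X\<in>Pow D. (- 1 :: 'k :: comm_ring_1) ^ card (X - A)) =
    (if D \<subseteq> A then 2 ^ card D else 0)"
proof -
  let ?f = "\<lambda>x. if x \<in> A then 1 else - 1 :: 'k"
  have f: "prod ?f X = (- 1) ^ card (X - A)" if "X \<subseteq> D" for X
    using finite_subset[OF that assms] by (simp add: prod.If_cases Diff_eq)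
  \<comment> \<open>The trivial factors over \<open>D - X\<close> bring the sum into the form of
    \<open>prod_add\<close>.\<close>
  have "(\<Sum>X\<in>Pow D. (- 1 :: 'k) ^ card (X - A)) = (\<Sum>X\<in>Pow D. prod ?f X * (\<Prod>x\<in>D - X. 1))"
    by (rule sum.cong) (auto simp: f)
  also have "\<dots> = (\<Prod>x\<in>D. ?f x + 1)"
    by (rule prod_add[OF assms, symmetric])
  also have "\<dots> = (if D \<subseteq> A then 2 ^ card D else 0)"
  proof (cases "D \<subseteq> A")
    case True
    then have "(\<Prod>x\<in>D. ?f x + 1) = (\<Prod>x\<in>D. 2)" by (intro prod.cong) auto
    with True show ?thesis by simp
  next
    case False
    then show ?thesis using assms by (auto intro!: prod_zero)
  qed
  finally show ?thesis .
qed

theorem proposition5: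
  fixes n :: nat and \<alpha> :: "nat list"
  assumes "0 < n" and "\<alpha> \<in> Comp n"
  shows "(enriched_monomial_qsym \<alpha> :: (nat, 'k :: comm_ring_1) mfps) =
           2 * (\<Sum>\<gamma>\<in>Comp n. (- 1) ^ card (Des \<gamma> - Des \<alpha>) * fundamental_qsym \<gamma>)"
proof (rule mfps_eqI)
  fix m :: "nat multiset"
  let ?A = "Des \<alpha>" and ?D = "ascents (sorted_of m)"
  let ?l = "coeff (enriched_monomial_qsym \<alpha> :: (nat, 'k) mfps) m"
  let ?r = "\<Sum>\<gamma>\<in>Comp n. (- 1) ^ card (Des \<gamma> - ?A) * coeff (fundamental_qsym \<gamma>) m :: 'k"
  have sum: "sum_list \<alpha> = n" using assms by (simp add: Comp_def)
  have l: "?l = (\<Sum>\<beta> | \<beta> \<in> Comp n \<and> Des \<beta> \<subseteq> ?A. 2 ^ length \<beta> * coeff (monomial_qsym \<beta>) m)"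
    by (simp add: enriched_monomial_qsym_def sum coeff_sum coeff_two_power_times)
  have "?l = 2 * ?r"
  proof (cases "size m = n \<and> 0 \<notin># m")
    \<comment> \<open>Here \<open>m\<close> has the wrong degree or involves \<open>var 0\<close>,
      so every coefficient on both sides vanishes.\<close>
    case False
    then have "coeff (monomial_qsym \<gamma>) m = (0 :: 'k)" "coeff (fundamental_qsym \<gamma>) m = (0 :: 'k)"
      if "\<gamma> \<in> Comp n" for \<gamma>
      using coeff_monomial_qsym[OF that, of m] coeff_fundamental_qsym[OF that, of m] by auto
    then show ?thesis unfolding l by simp
  next
    case True
    have D: "?D \<subseteq> {1..<n}"
      using ascents_subset[of "sorted_of m"] True
      by (metis mset_sorted_list_of_multiset size_mset)
    \<comment> \<open>Each summand is written through \<open>Des\<close> only, so that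
      \<open>bij_betw_Des\<close> can reindex the sum by subsets.\<close>
    have "?l = (\<Sum>\<beta>\<in>Comp n. if Des \<beta> \<subseteq> ?A \<and> Des \<beta> = ?D then 2 ^ Suc (card (Des \<beta>)) else 0)"
      unfolding l sum.inter_filter[OF finite_Comp]
    proof (rule sum.cong[OF refl])
      fix \<beta> assume \<beta>: "\<beta> \<in> Comp n"
      then have "length \<beta> = Suc (card (Des \<beta>))"
        using assms(1) by (intro length_eq_card_Des) (auto simp: Comp_def)
      then show "(if Des \<beta> \<subseteq> ?A then 2 ^ length \<beta> * coeff (monomial_qsym \<beta>) m else 0) =
          (if Des \<beta> \<subseteq> ?A \<and> Des \<beta> = ?D then 2 ^ Suc (card (Des \<beta>)) else (0 :: 'k))"
        using True \<beta> by (auto simp: coeff_monomial_qsym)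
    qed
    also have "\<dots> = (\<Sum>X\<in>Pow {1..<n}. if X \<subseteq> ?A \<and> X = ?D then 2 ^ Suc (card X) else 0)"
      by (rule sum.reindex_bij_betw[OF bij_betw_Des[OF assms(1)]])
    also have "\<dots> = (\<Sum>X\<in>Pow {1..<n}. if X = ?D then (if ?D \<subseteq> ?A then 2 ^ Suc (card ?D) else 0) else 0)"
      by (rule sum.cong) auto
    also have "\<dots> = (if ?D \<subseteq> ?A then 2 ^ Suc (card ?D) else 0)"
      using D by simp
    finally have left: "?l = (if ?D \<subseteq> ?A then 2 ^ Suc (card ?D) else 0)" .
    have "?r = (\<Sum>\<gamma>\<in>Comp n. if Des \<gamma> \<subseteq> ?D then (- 1) ^ card (Des \<gamma> - ?A) else 0)"
      using True by (intro sum.cong) (auto simp: coeff_fundamental_qsym)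
    also have "\<dots> = (\<Sum>X\<in>Pow {1..<n}. if X \<subseteq> ?D then (- 1) ^ card (X - ?A) else 0)"
      by (rule sum.reindex_bij_betw[OF bij_betw_Des[OF assms(1)]])
    also have "\<dots> = (\<Sum>X\<in>Pow ?D. (- 1) ^ card (X - ?A))"
      using D by (intro sum.mono_neutral_cong_right) auto
    also have "\<dots> = (if ?D \<subseteq> ?A then 2 ^ card ?D else 0)"
      using D by (intro sum_Pow_neg_one_power_card_Diff) (rule finite_subset, auto)
    \<comment> \<open>The outer factor 2 supplies the extra power in \<open>left\<close>, where the
      length is one more than the number of descents.\<close>
    finally show ?thesis using left by simp
  qed
  then show "?l = coeff (2 * (\<Sum>\<gamma>\<in>Comp n. (- 1) ^ card (Des \<gamma> - ?A) * fundamental_qsym \<gamma>)) m"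
    by (simp add: coeff_two_times coeff_sum coeff_neg_one_power_times)
qed

end
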